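(* Let $p,s,q,\omega\in C([a,b])$ with $p>0$ and $\omega>0$ on $[a,b]$. For each $\lambda\in\mathbb{R}$, let $\theta(x;\lambda)$ denote the solution to the initial value problem $$\theta'(x)=-\frac{\cos^2\theta(x)}{p(x)}-2s(x)\sin\theta(x)\cos\theta(x)+\bigl(q(x)-\lambda\omega(x)\bigr)\sin^2\theta(x),\qquad \theta(a;\lambda)=0,$$ and let $r(x;\lambda)$ denote the solution to $$r'(x)=r(x)\Big[-\frac{\cos\theta(x)\sin\theta(x)}{p(x)}-s(x)\sin^2\theta(x)+s(x)\cos^2\theta(x)-\bigl(q(x)-\lambda\omega(x)\bigr)\sin\theta(x)\cos\theta(x)\Big],\qquad r(a;\lambda)=r_0>0,$$ where $\theta(x)=\theta(x;\lambda)$. Then $\lambda$ is an eigenvalue of the boundary value problem $$-\left(p(x)(y'(x)+s(x)y(x))\right)'+s(x)p(x)(y'(x)+s(x)y(x))+q(x)y(x)=\lambda\,\omega(x)y(x)$$ with Dirichlet conditions $y(a)=y(b)=0$ if and only if $\theta(b;\lambda)=n\pi$ for some positive integer $n\in\mathbb{N}$. In this case, the corresponding eigenfunction is $y(x)=r(x;\lambda)\sin\theta(x;\lambda)$.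
   Context: Here $[a,b]$ is a compact interval with $a<b$, and $C([a,b])$ is the space of continuous functions on it. The functions $\theta$ and $r$ are the phase and amplitude of the Prüfer substitution $y=r\sin\theta$, $p(y'+sy)=-r\cos\theta$. A number $\lambda$ is an eigenvalue if the boundary value problem has a solution $y$ that is not identically zero; such a $y$ is a corresponding eigenfunction.
   Formalization: The condition θ(b;λ) = nπ is corrected to θ(b;λ) = −nπ (n a positive integer): with the stated equations θ is negative on (a,b], e.g. p=ω=1, s=q=0, λ=1 on [0,π] gives θ(π) = −π although λ=1 is an eigenvalue. *)

theory Defs
  imports Complex_Main
begin

text \<open>
  A classical solution of
  \<open>- (p (y' + s y))' + s p (y' + s y) + q y = lam \<omega> y\<close> on \<open>{a..b}\<close>:
  \<open>p\<close> and \<open>s\<close> are merely continuous, so only \<open>y\<close> and the quasi-derivative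
  \<open>p (y' + s y)\<close> are required to be differentiable, not \<open>y'\<close> itself.  Derivatives at the end
  points are one-sided, and values of \<open>y\<close> outside \<open>{a..b}\<close> are irrelevant.
\<close>

definition sl_solution ::
  "real \<Rightarrow> real \<Rightarrow> (real \<Rightarrow> real) \<Rightarrow> (real \<Rightarrow> real) \<Rightarrow> (real \<Rightarrow> real) \<Rightarrow> (real \<Rightarrow> real)
    \<Rightarrow> real \<Rightarrow> (real \<Rightarrow> real) \<Rightarrow> bool"
where
  "sl_solution a b p s q \<omega> lam y \<longleftrightarrow>
    (\<exists>y' u'. \<forall>x\<in>{a..b}.
       (y has_real_derivative y' x) (at x within {a..b}) \<and>
       ((\<lambda>t. p t * (y' t + s t * y t)) has_real_derivative u' x) (at x within {a..b}) \<and>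
       - u' x + s x * p x * (y' x + s x * y x) + q x * y x = lam * \<omega> x * y x)"

definition sl_eigenfunction ::
  "real \<Rightarrow> real \<Rightarrow> (real \<Rightarrow> real) \<Rightarrow> (real \<Rightarrow> real) \<Rightarrow> (real \<Rightarrow> real) \<Rightarrow> (real \<Rightarrow> real)
    \<Rightarrow> real \<Rightarrow> (real \<Rightarrow> real) \<Rightarrow> bool"
where
  "sl_eigenfunction a b p s q \<omega> lam y \<longleftrightarrow>
    sl_solution a b p s q \<omega> lam y \<and> y a = 0 \<and> y b = 0 \<and> (\<exists>x\<in>{a..b}. y x \<noteq> 0)"

definition sl_eigenvalue ::
  "real \<Rightarrow> real \<Rightarrow> (real \<Rightarrow> real) \<Rightarrow> (real \<Rightarrow> real) \<Rightarrow> (real \<Rightarrow> real) \<Rightarrow> (real \<Rightarrow> real)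
    \<Rightarrow> real \<Rightarrow> bool"
where
  "sl_eigenvalue a b p s q \<omega> lam \<longleftrightarrow> (\<exists>y. sl_eigenfunction a b p s q \<omega> lam y)"

text \<open>
  The initial value problems for phase and amplitude come from the substitution
  \<open>y = r sin \<theta>\<close>, \<open>p (y' + s y) = - r cos \<theta>\<close>.  With this choice of sign
  \<open>\<theta>' = - 1 / p < 0\<close> wherever \<open>sin \<theta> = 0\<close>, so a phase starting from \<open>0\<close> crosses multiples
  of \<open>pi\<close> downwards only, and the Dirichlet condition at \<open>b\<close> is met at \<open>- n pi\<close> with
  \<open>n\<close> a positive integer.  The source writes \<open>n pi\<close>, which this phase never attains at \<open>b\<close>:
  for \<open>p = \<omega> = 1\<close>, \<open>s = q = 0\<close>, \<open>lam = 1\<close> on \<open>{0..pi}\<close> one has \<open>\<theta> x = - x\<close>,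
  while \<open>1\<close> is an eigenvalue with the eigenfunction \<open>sin\<close>.
\<close>

definition pruefer_phase ::
  "real \<Rightarrow> real \<Rightarrow> (real \<Rightarrow> real) \<Rightarrow> (real \<Rightarrow> real) \<Rightarrow> (real \<Rightarrow> real) \<Rightarrow> (real \<Rightarrow> real)
    \<Rightarrow> real \<Rightarrow> (real \<Rightarrow> real) \<Rightarrow> bool"
where
  "pruefer_phase a b p s q \<omega> lam \<theta> \<longleftrightarrow>
    \<theta> a = 0 \<and>
    (\<forall>x\<in>{a..b}.
       (\<theta> has_real_derivative
          - ((cos (\<theta> x))\<^sup>2 / p x) - 2 * s x * sin (\<theta> x) * cos (\<theta> x)
          + (q x - lam * \<omega> x) * (sin (\<theta> x))\<^sup>2) (at x within {a..b}))"

definition pruefer_amplitude ::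
  "real \<Rightarrow> real \<Rightarrow> (real \<Rightarrow> real) \<Rightarrow> (real \<Rightarrow> real) \<Rightarrow> (real \<Rightarrow> real) \<Rightarrow> (real \<Rightarrow> real)
    \<Rightarrow> real \<Rightarrow> (real \<Rightarrow> real) \<Rightarrow> real \<Rightarrow> (real \<Rightarrow> real) \<Rightarrow> bool"
where
  "pruefer_amplitude a b p s q \<omega> lam \<theta> r0 r \<longleftrightarrow>
    r a = r0 \<and>
    (\<forall>x\<in>{a..b}.
       (r has_real_derivative
          r x * (- (cos (\<theta> x) * sin (\<theta> x) / p x) - s x * (sin (\<theta> x))\<^sup>2 + s x * (cos (\<theta> x))\<^sup>2
                 - (q x - lam * \<omega> x) * sin (\<theta> x) * cos (\<theta> x))) (at x within {a..b}))"

end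

theory Submission
  imports Defs "HOL-Analysis.Analysis"
begin

text \<open>
  In terms of \<open>y\<close> and its quasi-derivative \<open>v = p (y' + s y)\<close> the differential equation is the
  linear first order system \<open>y' = v / p - s y\<close>, \<open>v' = s v + (q - lam \<omega>) y\<close>, and the phase and
  amplitude equations say exactly that \<open>y = r sin \<theta>\<close>, \<open>v = - r cos \<theta>\<close> solve it
  (\<open>pruefer_sl_system\<close>).  The amplitude satisfies a homogeneous linear equation and starts at
  \<open>r0 > 0\<close>, so it never vanishes; hence \<open>y\<^sup>2 + v\<^sup>2 = r\<^sup>2 \<noteq> 0\<close> everywhere, and the
  zeros of \<open>y\<close> are the points where \<open>\<theta>\<close> is a multiple of \<open>pi\<close>.

  Since \<open>\<theta> a = 0\<close>, this particular solution vanishes at \<open>a\<close>.  Any other solution vanishing at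
  \<open>a\<close> has zero Wronskian with it and is therefore a constant multiple of it
  (\<open>sl_system_proportional\<close>).  So all eigenfunctions for \<open>lam\<close> are multiples of \<open>r sin \<theta>\<close>, and
  \<open>lam\<close> is an eigenvalue if and only if \<open>sin (\<theta> b) = 0\<close>.

  It remains to see which multiples of \<open>pi\<close> can occur.  Wherever \<open>\<theta> = 0\<close>, the phase equation
  gives \<open>\<theta>' = - 1 / p < 0\<close>, so \<open>\<theta>\<close> becomes negative after \<open>a\<close> and cannot return to \<open>0\<close>
  (\<open>negative_if_decreasing_at_zeros\<close>).  Thus \<open>\<theta> b\<close> is a negative multiple of \<open>pi\<close>.
\<close>

section \<open>Real functions on a compact interval\<close>

lemma zero_derivative_constant:
  fixes f :: "real \<Rightarrow> real"
  assumes "\<And>x. x \<in> {a..b} \<Longrightarrow> (f has_real_derivative 0) (at x within {a..b})"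
    and "x \<in> {a..b}"
  shows "f x = f a"
proof -
  have "\<exists>c. \<forall>x\<in>{a..b}. f x = c"
    using has_field_derivative_zero_constant[of "{a..b}" f] assms(1) by auto
  then show ?thesis using assms(2) by force
qed

text \<open>With \<open>G\<close> an antiderivative of \<open>g\<close>, the function \<open>r exp (- G)\<close> has derivative zero, so
  \<open>r\<close> is \<open>r a\<close> times an exponential.\<close>

lemma linear_ode_nonzero:
  fixes r g :: "real \<Rightarrow> real"
  assumes "continuous_on {a..b} g"
    and der: "\<And>x. x \<in> {a..b} \<Longrightarrow> (r has_real_derivative r x * g x) (at x within {a..b})"
    and "r a \<noteq> 0" and x: "x \<in> {a..b}"
  shows "r x \<noteq> 0"
proof -
  obtain G where G: "\<And>x. x \<in> {a..b} \<Longrightarrow> (G has_real_derivative g x) (at x within {a..b})"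
    using antiderivative_continuous[OF assms(1)]
    by (auto simp: has_real_derivative_iff_has_vector_derivative)
  have "((\<lambda>x. r x * exp (- G x)) has_real_derivative 0) (at x within {a..b})"
    if "x \<in> {a..b}" for x
    by (rule derivative_eq_intros der[OF that] G[OF that] refl)+ simp
  from zero_derivative_constant[OF this x]
  have "r x * exp (- G x) = r a * exp (- G a)" by simp
  with \<open>r a \<noteq> 0\<close> show ?thesis by auto
qed

text \<open>A negative derivative at \<open>a\<close> makes \<open>f\<close> negative just after \<open>a\<close>.  If \<open>f\<close> were nonnegative
  later on, then just before its first nonnegative value, which is a zero, it would have to be
  positive already, as it is decreasing there.\<close>

lemma negative_if_decreasing_at_zeros:
  fixes f f' :: "real \<Rightarrow> real"
  assumes der: "\<And>x. x \<in> {a..b} \<Longrightarrow> (f has_real_derivative f' x) (at x within {a..b})"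
    and neg: "\<And>x. x \<in> {a..b} \<Longrightarrow> f x = 0 \<Longrightarrow> f' x < 0"
    and "f a = 0" and x: "a < x" "x \<le> b"
  shows "f x < 0"
proof (rule ccontr)
  assume "\<not> f x < 0"
  have cont: "continuous_on {a..b} f"
    using der by (rule DERIV_continuous_on)
  obtain d where "d > 0" and d: "\<And>h. 0 < h \<Longrightarrow> a + h \<in> {a..b} \<Longrightarrow> h < d \<Longrightarrow> f (a + h) < f a"
    using has_real_derivative_neg_dec_right[OF der[of a] neg[of a]] x \<open>f a = 0\<close> by auto
  define h where "h = min (d / 2) (x - a)"
  have h: "0 < h" "h < d" "a + h \<le> x"
    using \<open>d > 0\<close> x by (auto simp: h_def)
  then have fh: "f (a + h) < 0"
    using d[of h] x \<open>f a = 0\<close> by auto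
  have "continuous_on {a + h..x} f"
    using cont by (rule continuous_on_subset) (use h x in auto)
  then have "closed ({a + h..x} \<inter> f -` {0..})"
    by (rule continuous_closed_preimage) auto
  then have "compact ({a + h..x} \<inter> f -` {0..})"
    by (auto simp: compact_eq_bounded_closed intro: bounded_subset[of "{a + h..x}"])
  moreover have "{a + h..x} \<inter> f -` {0..} \<noteq> {}"
    using \<open>\<not> f x < 0\<close> h by force
  ultimately obtain z where "z \<in> {a + h..x} \<inter> f -` {0..}"
    and "\<forall>t\<in>{a + h..x} \<inter> f -` {0..}. z \<le> t"
    using compact_attains_inf by metis
  then have z: "a + h \<le> z" "z \<le> x" "f z \<ge> 0"
    and least: "\<And>t. a + h \<le> t \<Longrightarrow> t \<le> x \<Longrightarrow> f t \<ge> 0 \<Longrightarrow> z \<le> t"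
    by auto
  have z': "a + h < z" using z fh by (cases "z = a + h") auto
  have "\<exists>t\<ge>a + h. t \<le> z \<and> f t = 0"
    by (rule IVT') (use z fh h x in \<open>auto intro: continuous_on_subset[OF cont]\<close>)
  then have "f z = 0" using least z by force
  then obtain e where "e > 0"
    and e: "\<And>k. 0 < k \<Longrightarrow> z - k \<in> {a..b} \<Longrightarrow> k < e \<Longrightarrow> f z < f (z - k)"
    using has_real_derivative_neg_dec_left[OF der[of z] neg[of z]] x z h by auto
  define k where "k = min (e / 2) (z - (a + h))"
  have k: "0 < k" "k < e" "a + h \<le> z - k"
    using \<open>e > 0\<close> z' by (auto simp: k_def)
  then have "f (z - k) > 0"
    using e[of k] z h x \<open>f z = 0\<close> by auto
  then show False using least[of "z - k"] k z by auto
qed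

section \<open>The equation as a first order system\<close>

definition sl_system ::
  "real \<Rightarrow> real \<Rightarrow> (real \<Rightarrow> real) \<Rightarrow> (real \<Rightarrow> real) \<Rightarrow> (real \<Rightarrow> real)
    \<Rightarrow> (real \<Rightarrow> real) \<Rightarrow> (real \<Rightarrow> real) \<Rightarrow> bool"
where
  "sl_system a b p s Q y v \<longleftrightarrow>
    (\<forall>x\<in>{a..b}.
       (y has_real_derivative v x / p x - s x * y x) (at x within {a..b}) \<and>
       (v has_real_derivative s x * v x + Q x * y x) (at x within {a..b}))"

text \<open>The second unknown is the quasi-derivative \<open>v = p (y' + s y)\<close>.  Conversely, \<open>v\<close> determines
  \<open>y'\<close> because \<open>p\<close> has no zeros, and it then agrees with the quasi-derivative on \<open>{a..b}\<close>.\<close>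

lemma sl_solution_iff_system:
  assumes p: "\<And>x. x \<in> {a..b} \<Longrightarrow> p x \<noteq> 0"
  shows "sl_solution a b p s q \<omega> lam y \<longleftrightarrow>
    (\<exists>v. sl_system a b p s (\<lambda>x. q x - lam * \<omega> x) y v)"
proof
  assume "sl_solution a b p s q \<omega> lam y"
  then obtain y' u' where sol: "\<And>x. x \<in> {a..b} \<Longrightarrow>
       (y has_real_derivative y' x) (at x within {a..b}) \<and>
       ((\<lambda>t. p t * (y' t + s t * y t)) has_real_derivative u' x) (at x within {a..b}) \<and>
       - u' x + s x * p x * (y' x + s x * y x) + q x * y x = lam * \<omega> x * y x"
    unfolding sl_solution_def by blast
  define v where "v = (\<lambda>t. p t * (y' t + s t * y t))"
  have "(y has_real_derivative v x / p x - s x * y x) (at x within {a..b}) \<and>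
      (v has_real_derivative s x * v x + (q x - lam * \<omega> x) * y x) (at x within {a..b})"
    if x: "x \<in> {a..b}" for x
  proof -
    have "s x * p x * (y' x + s x * y x) = s x * v x"
      by (simp add: v_def)
    then have "u' x = s x * v x + (q x - lam * \<omega> x) * y x"
      using sol[OF x] unfolding left_diff_distrib by linarith
    moreover have "y' x = v x / p x - s x * y x"
      using p[OF x] by (simp add: v_def)
    ultimately show ?thesis
      using sol[OF x] unfolding v_def[symmetric] by metis
  qed
  then have "sl_system a b p s (\<lambda>x. q x - lam * \<omega> x) y v"
    by (simp add: sl_system_def)
  then show "\<exists>v. sl_system a b p s (\<lambda>x. q x - lam * \<omega> x) y v" by blast
next
  assume "\<exists>v. sl_system a b p s (\<lambda>x. q x - lam * \<omega> x) y v"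
  then obtain v where sys: "sl_system a b p s (\<lambda>x. q x - lam * \<omega> x) y v" ..
  define y' where "y' = (\<lambda>x. v x / p x - s x * y x)"
  define u' where "u' = (\<lambda>x. s x * v x + (q x - lam * \<omega> x) * y x)"
  have v: "p x * (y' x + s x * y x) = v x" if "x \<in> {a..b}" for x
    using p[OF that] by (simp add: y'_def)
  have "(y has_real_derivative y' x) (at x within {a..b}) \<and>
       ((\<lambda>t. p t * (y' t + s t * y t)) has_real_derivative u' x) (at x within {a..b}) \<and>
       - u' x + s x * p x * (y' x + s x * y x) + q x * y x = lam * \<omega> x * y x"
    if x: "x \<in> {a..b}" for x
  proof (intro conjI)
    show "(y has_real_derivative y' x) (at x within {a..b})"
      using sys x by (simp add: sl_system_def y'_def)
    have "(v has_real_derivative u' x) (at x within {a..b})"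
      using sys x by (simp add: sl_system_def u'_def)
    then show "((\<lambda>t. p t * (y' t + s t * y t)) has_real_derivative u' x) (at x within {a..b})"
      by (rule has_field_derivative_transform_within[where d = 1]) (use x v in auto)
    have "s x * p x * (y' x + s x * y x) = s x * v x"
      using v[OF x] by (simp add: mult.assoc)
    then show "- u' x + s x * p x * (y' x + s x * y x) + q x * y x = lam * \<omega> x * y x"
      by (simp add: u'_def algebra_simps)
  qed
  then show "sl_solution a b p s q \<omega> lam y"
    unfolding sl_solution_def by blast
qed

text \<open>The coefficient matrix of the system has trace zero.\<close>

lemma sl_system_wronskian_constant:
  assumes "sl_system a b p s Q y v" and "sl_system a b p s Q z u" and x: "x \<in> {a..b}"
  shows "z x * v x - u x * y x = z a * v a - u a * y a"
proof -
  have "((\<lambda>x. z x * v x - u x * y x) has_real_derivative 0) (at x within {a..b})"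
    if "x \<in> {a..b}" for x
  proof -
    have *: "(y has_real_derivative v x / p x - s x * y x) (at x within {a..b})"
      "(v has_real_derivative s x * v x + Q x * y x) (at x within {a..b})"
      "(z has_real_derivative u x / p x - s x * z x) (at x within {a..b})"
      "(u has_real_derivative s x * u x + Q x * z x) (at x within {a..b})"
      using assms that by (auto simp: sl_system_def)
    show ?thesis
      by (rule derivative_eq_intros * refl)+ (simp add: algebra_simps)
  qed
  from zero_derivative_constant[OF this x] show ?thesis by simp
qed

text \<open>The Wronskian vanishes, so at each point \<open>(z, u) = c (y, v)\<close> with a factor \<open>c\<close>, which is
  given by projection on \<open>(y, v)\<close>.  As the system is linear, the derivatives then satisfy
  \<open>(z', u') = c (y', v')\<close> with the same \<open>c\<close>, and the quotient rule gives \<open>c' = 0\<close>.\<close>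

lemma sl_system_proportional:
  assumes yv: "sl_system a b p s Q y v" and zu: "sl_system a b p s Q z u"
    and "y a = 0" and "z a = 0"
    and nz: "\<And>x. x \<in> {a..b} \<Longrightarrow> (y x)\<^sup>2 + (v x)\<^sup>2 \<noteq> 0"
  obtains c where "\<And>x. x \<in> {a..b} \<Longrightarrow> z x = c * y x"
proof
  define c where "c = (\<lambda>x. (z x * y x + u x * v x) / ((y x)\<^sup>2 + (v x)\<^sup>2))"
  have zc: "z x = c x * y x" and uc: "u x = c x * v x" if x: "x \<in> {a..b}" for x
  proof -
    have W: "z x * v x = u x * y x"
      using sl_system_wronskian_constant[OF yv zu x] \<open>y a = 0\<close> \<open>z a = 0\<close> by simp
    have "(z x * y x + u x * v x) * y x = z x * ((y x)\<^sup>2 + (v x)\<^sup>2)"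
      using W by algebra
    then show "z x = c x * y x"
      using nz[OF x] by (simp add: c_def field_simps)
    have "(z x * y x + u x * v x) * v x = u x * ((y x)\<^sup>2 + (v x)\<^sup>2)"
      using W by algebra
    then show "u x = c x * v x"
      using nz[OF x] by (simp add: c_def field_simps)
  qed
  have "(c has_real_derivative 0) (at x within {a..b})" if x: "x \<in> {a..b}" for x
  proof -
    define y' v' where "y' = v x / p x - s x * y x" and "v' = s x * v x + Q x * y x"
    have y'v': "(y has_real_derivative y') (at x within {a..b})"
      "(v has_real_derivative v') (at x within {a..b})"
      using yv x by (auto simp: sl_system_def y'_def v'_def)
    have "u x / p x - s x * z x = c x * y'" "s x * u x + Q x * z x = c x * v'"
      unfolding zc[OF x] uc[OF x] y'_def v'_def by (simp_all add: algebra_simps)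
    then have "(z has_real_derivative c x * y') (at x within {a..b})"
      "(u has_real_derivative c x * v') (at x within {a..b})"
      using zu x unfolding sl_system_def by metis+
    note * = y'v' this
    have "((\<lambda>x. z x * y x + u x * v x) has_real_derivative c x * (2 * y x * y' + 2 * v x * v'))
        (at x within {a..b})"
      by (rule derivative_eq_intros * refl)+ (simp add: zc[OF x] uc[OF x] algebra_simps)
    moreover have "((\<lambda>x. (y x)\<^sup>2 + (v x)\<^sup>2) has_real_derivative 2 * y x * y' + 2 * v x * v')
        (at x within {a..b})"
      by (rule derivative_eq_intros * refl)+ simp
    ultimately have "(c has_real_derivative
        (c x * (2 * y x * y' + 2 * v x * v') * ((y x)\<^sup>2 + (v x)\<^sup>2)
          - (z x * y x + u x * v x) * (2 * y x * y' + 2 * v x * v'))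
        / (((y x)\<^sup>2 + (v x)\<^sup>2) * ((y x)\<^sup>2 + (v x)\<^sup>2))) (at x within {a..b})"
      unfolding c_def by (rule DERIV_divide) (use nz[OF x] in simp)
    moreover have "c x * ((y x)\<^sup>2 + (v x)\<^sup>2) = z x * y x + u x * v x"
      using nz[OF x] by (simp add: c_def)
    then have "c x * (2 * y x * y' + 2 * v x * v') * ((y x)\<^sup>2 + (v x)\<^sup>2)
          - (z x * y x + u x * v x) * (2 * y x * y' + 2 * v x * v') = 0"
      by algebra
    ultimately show ?thesis by simp
  qed
  from zero_derivative_constant[OF this] show "z x = c a * y x" if "x \<in> {a..b}" for x
    using zc[OF that] that by metis
qed

section \<open>Phase and amplitude\<close>

lemma pruefer_phase_continuous:
  assumes "pruefer_phase a b p s q \<omega> lam \<theta>"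
  shows "continuous_on {a..b} \<theta>"
  by (rule DERIV_continuous_on) (rule bspec[OF conjunct2[OF assms[unfolded pruefer_phase_def]]])

lemma pruefer_phase_negative:
  assumes phase: "pruefer_phase a b p s q \<omega> lam \<theta>"
    and p: "\<And>x. x \<in> {a..b} \<Longrightarrow> p x > 0"
    and x: "a < x" "x \<le> b"
  shows "\<theta> x < 0"
proof (rule negative_if_decreasing_at_zeros[OF _ _ _ x])
  show "(\<theta> has_real_derivative
          - ((cos (\<theta> x))\<^sup>2 / p x) - 2 * s x * sin (\<theta> x) * cos (\<theta> x)
          + (q x - lam * \<omega> x) * (sin (\<theta> x))\<^sup>2) (at x within {a..b})"
    if "x \<in> {a..b}" for x
    using phase that by (simp add: pruefer_phase_def)
  show "- ((cos (\<theta> x))\<^sup>2 / p x) - 2 * s x * sin (\<theta> x) * cos (\<theta> x)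
          + (q x - lam * \<omega> x) * (sin (\<theta> x))\<^sup>2 < 0"
    if "x \<in> {a..b}" "\<theta> x = 0" for x
    using p[OF that(1)] that(2) by simp
  show "\<theta> a = 0"
    using phase by (simp add: pruefer_phase_def)
qed

lemma pruefer_amplitude_nonzero:
  assumes "continuous_on {a..b} p" and "continuous_on {a..b} s"
    and "continuous_on {a..b} q" and "continuous_on {a..b} \<omega>"
    and p: "\<And>x. x \<in> {a..b} \<Longrightarrow> p x \<noteq> 0"
    and phase: "pruefer_phase a b p s q \<omega> lam \<theta>"
    and amp: "pruefer_amplitude a b p s q \<omega> lam \<theta> r0 r"
    and "r0 \<noteq> 0" and x: "x \<in> {a..b}"
  shows "r x \<noteq> 0"
proof (rule linear_ode_nonzero[OF _ _ _ x])
  show "continuous_on {a..b} (\<lambda>x. - (cos (\<theta> x) * sin (\<theta> x) / p x) - s x * (sin (\<theta> x))\<^sup>2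
      + s x * (cos (\<theta> x))\<^sup>2 - (q x - lam * \<omega> x) * sin (\<theta> x) * cos (\<theta> x))"
    using p by (intro continuous_intros assms(1-4) pruefer_phase_continuous[OF phase]) auto
qed (use amp \<open>r0 \<noteq> 0\<close> in \<open>auto simp: pruefer_amplitude_def\<close>)

lemma pruefer_sl_system:
  assumes "pruefer_phase a b p s q \<omega> lam \<theta>"
    and "pruefer_amplitude a b p s q \<omega> lam \<theta> r0 r"
  shows "sl_system a b p s (\<lambda>x. q x - lam * \<omega> x)
    (\<lambda>x. r x * sin (\<theta> x)) (\<lambda>x. - (r x * cos (\<theta> x)))"
  unfolding sl_system_def
proof (intro ballI conjI)
  fix x assume x: "x \<in> {a..b}"
  \<comment> \<open>In terms of these, both equations of the system become polynomial identities modulo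
    \<open>S\<^sup>2 + C\<^sup>2 = 1\<close>.\<close>
  define S C P Q where "S = sin (\<theta> x)" and "C = cos (\<theta> x)" and "P = 1 / p x"
    and "Q = q x - lam * \<omega> x"
  have SC: "S\<^sup>2 + C\<^sup>2 = 1" by (simp add: S_def C_def)
  define \<theta>' where "\<theta>' = - (C\<^sup>2 * P) - 2 * s x * S * C + Q * S\<^sup>2"
  define r' where "r' = r x * (- (C * S * P) - s x * S\<^sup>2 + s x * C\<^sup>2 - Q * S * C)"
  have *: "(\<theta> has_real_derivative \<theta>') (at x within {a..b})"
    "(r has_real_derivative r') (at x within {a..b})"
    using assms x
    by (auto simp: pruefer_phase_def pruefer_amplitude_def \<theta>'_def r'_def S_def C_def P_def Q_def)
  have "((\<lambda>x. r x * sin (\<theta> x)) has_real_derivative r' * S + r x * (C * \<theta>'))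
      (at x within {a..b})"
    by (rule derivative_eq_intros * refl)+ (simp add: S_def C_def)
  moreover have "r' * S + r x * (C * \<theta>') = - (r x * C) * P - s x * (r x * S)"
    using SC unfolding r'_def \<theta>'_def by algebra
  ultimately show "((\<lambda>x. r x * sin (\<theta> x)) has_real_derivative
      - (r x * cos (\<theta> x)) / p x - s x * (r x * sin (\<theta> x))) (at x within {a..b})"
    by (simp add: S_def C_def P_def)
  have "((\<lambda>x. - (r x * cos (\<theta> x))) has_real_derivative - (r' * C) + r x * (S * \<theta>'))
      (at x within {a..b})"
    by (rule derivative_eq_intros * refl)+ (simp add: S_def C_def)
  moreover have "- (r' * C) + r x * (S * \<theta>') = s x * - (r x * C) + Q * (r x * S)"
    using SC unfolding r'_def \<theta>'_def by algebra
  ultimately show "((\<lambda>x. - (r x * cos (\<theta> x))) has_real_derivative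
      s x * - (r x * cos (\<theta> x)) + (q x - lam * \<omega> x) * (r x * sin (\<theta> x))) (at x within {a..b})"
    by (simp add: S_def C_def Q_def)
qed

section \<open>Dirichlet eigenvalues\<close>

theorem theorem3p6:
  fixes a b r0 :: real
    and p s q \<omega> :: "real \<Rightarrow> real"
    and \<theta> r :: "real \<Rightarrow> real \<Rightarrow> real"
  assumes "a < b"
    and "continuous_on {a..b} p" and "continuous_on {a..b} s"
    and "continuous_on {a..b} q" and "continuous_on {a..b} \<omega>"
    and "\<And>x. x \<in> {a..b} \<Longrightarrow> p x > 0" and "\<And>x. x \<in> {a..b} \<Longrightarrow> \<omega> x > 0"
    and "r0 > 0"
    and "\<And>lam. pruefer_phase a b p s q \<omega> lam (\<lambda>x. \<theta> x lam)"
    and "\<And>lam. pruefer_amplitude a b p s q \<omega> lam (\<lambda>x. \<theta> x lam) r0 (\<lambda>x. r x lam)"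
  shows "\<forall>lam.
    (sl_eigenvalue a b p s q \<omega> lam \<longleftrightarrow> (\<exists>n::nat. n > 0 \<and> \<theta> b lam = - (real n * pi))) \<and>
    (sl_eigenvalue a b p s q \<omega> lam \<longrightarrow>
       sl_eigenfunction a b p s q \<omega> lam (\<lambda>x. r x lam * sin (\<theta> x lam)) \<and>
       (\<forall>z. sl_eigenfunction a b p s q \<omega> lam z \<longrightarrow>
          (\<exists>c. c \<noteq> 0 \<and> (\<forall>x\<in>{a..b}. z x = c * (r x lam * sin (\<theta> x lam))))))"
proof
  fix lam
  define y where "y = (\<lambda>x. r x lam * sin (\<theta> x lam))"
  define v where "v = (\<lambda>x. - (r x lam * cos (\<theta> x lam)))"
  have p: "p x \<noteq> 0" if "x \<in> {a..b}" for x
    using assms(6)[OF that] by simp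
  have r: "r x lam \<noteq> 0" if "x \<in> {a..b}" for x
    using pruefer_amplitude_nonzero[OF assms(2-5) p assms(9,10) _ that] \<open>r0 > 0\<close> by simp
  have sys: "sl_system a b p s (\<lambda>x. q x - lam * \<omega> x) y v"
    unfolding y_def v_def by (rule pruefer_sl_system[OF assms(9,10)])
  have \<theta>a: "\<theta> a lam = 0"
    using assms(9)[of lam] by (simp add: pruefer_phase_def)
  then have ya: "y a = 0" by (simp add: y_def)
  have \<theta>b: "\<theta> b lam < 0"
    by (rule pruefer_phase_negative[OF assms(9,6)]) (use \<open>a < b\<close> in auto)

  have mult: "\<exists>c. c \<noteq> 0 \<and> (\<forall>x\<in>{a..b}. z x = c * y x)"
    if "sl_eigenfunction a b p s q \<omega> lam z" for z
  proof -
    have z: "sl_solution a b p s q \<omega> lam z" "z a = 0" and "\<exists>x\<in>{a..b}. z x \<noteq> 0"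
      using that by (auto simp: sl_eigenfunction_def)
    from z(1) obtain u where u: "sl_system a b p s (\<lambda>x. q x - lam * \<omega> x) z u"
      using sl_solution_iff_system[OF p] by auto
    have nz: "(y x)\<^sup>2 + (v x)\<^sup>2 \<noteq> 0" if "x \<in> {a..b}" for x
    proof -
      have "(y x)\<^sup>2 + (v x)\<^sup>2 = (r x lam)\<^sup>2 * ((sin (\<theta> x lam))\<^sup>2 + (cos (\<theta> x lam))\<^sup>2)"
        unfolding y_def v_def by algebra
      then show ?thesis using r[OF that] by simp
    qed
    obtain c where c: "\<And>x. x \<in> {a..b} \<Longrightarrow> z x = c * y x"
      using sl_system_proportional[OF sys u ya z(2) nz] by blast
    with \<open>\<exists>x\<in>{a..b}. z x \<noteq> 0\<close> show ?thesis by (intro exI[of _ c]) auto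
  qed

  have to_pi: "\<exists>n::nat. n > 0 \<and> \<theta> b lam = - (real n * pi)"
    if ev: "sl_eigenvalue a b p s q \<omega> lam"
  proof -
    from ev obtain z where z: "sl_eigenfunction a b p s q \<omega> lam z"
      by (auto simp: sl_eigenvalue_def)
    with mult obtain c where "c \<noteq> 0" "\<forall>x\<in>{a..b}. z x = c * y x" by blast
    moreover have "z b = 0" using z by (simp add: sl_eigenfunction_def)
    ultimately have "y b = 0" using \<open>a < b\<close> by auto
    then have "sin (\<theta> b lam) = 0"
      using r[of b] \<open>a < b\<close> by (simp add: y_def)
    then obtain k :: int where k: "\<theta> b lam = of_int k * pi"
      by (auto simp: sin_zero_iff_int2)
    with \<theta>b have "k < 0" by (simp add: mult_less_0_iff)
    then show ?thesis using k by (intro exI[of _ "nat (- k)"]) simp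
  qed

  have from_pi: "sl_eigenfunction a b p s q \<omega> lam y"
    if "n > 0" and n: "\<theta> b lam = - (real n * pi)" for n :: nat
  proof -
    have "sl_solution a b p s q \<omega> lam y"
      using sys sl_solution_iff_system[OF p] by auto
    moreover have "y b = 0" by (simp add: y_def n)
    \<comment> \<open>The phase runs through \<open>- pi / 2\<close>, where the sine is not zero.\<close>
    moreover have "\<exists>x\<in>{a..b}. y x \<noteq> 0"
    proof -
      have "1 * pi \<le> real n * pi"
        using \<open>n > 0\<close> by (intro mult_right_mono) auto
      then have "\<theta> b lam \<le> - pi / 2"
        using n pi_gt_zero by linarith
      then have "\<exists>x\<ge>a. x \<le> b \<and> \<theta> x lam = - pi / 2"
        using \<theta>a \<open>a < b\<close> pruefer_phase_continuous[OF assms(9)]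
        by (intro IVT2') auto
      then obtain x where x: "x \<in> {a..b}" "\<theta> x lam = - pi / 2" by auto
      then have "y x \<noteq> 0" using r[of x] by (simp add: y_def)
      with x show ?thesis by auto
    qed
    ultimately show ?thesis using ya by (simp add: sl_eigenfunction_def)
  qed

  have "sl_eigenvalue a b p s q \<omega> lam \<longleftrightarrow> (\<exists>n::nat. n > 0 \<and> \<theta> b lam = - (real n * pi))"
    using to_pi from_pi by (auto simp: sl_eigenvalue_def)
  moreover have "sl_eigenfunction a b p s q \<omega> lam y" if "sl_eigenvalue a b p s q \<omega> lam"
    using to_pi[OF that] from_pi by auto
  ultimately show "(sl_eigenvalue a b p s q \<omega> lam \<longleftrightarrow>
      (\<exists>n::nat. n > 0 \<and> \<theta> b lam = - (real n * pi))) \<and>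
    (sl_eigenvalue a b p s q \<omega> lam \<longrightarrow>
       sl_eigenfunction a b p s q \<omega> lam (\<lambda>x. r x lam * sin (\<theta> x lam)) \<and>
       (\<forall>z. sl_eigenfunction a b p s q \<omega> lam z \<longrightarrow>
          (\<exists>c. c \<noteq> 0 \<and> (\<forall>x\<in>{a..b}. z x = c * (r x lam * sin (\<theta> x lam))))))"
    using mult unfolding y_def by blast
qed

end
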